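(* $J_{3}[73]=I_{3}[73]$.
   Context: An $S(2,4,v)$ design is a pair $(\mathcal{V},\mathcal{B})$ with $|\mathcal{V}|=v$ and $\mathcal{B}$ a family of 4-subsets (blocks) of $\mathcal{V}$ such that each 2-subset of $\mathcal{V}$ lies in exactly one block; it has $b_v=\frac{v(v-1)}{12}$ blocks. For integers $a\le b$, $[a,b]=\{a,\dots,b\}$, and $I_{3}[v]=[0,b_{v}]\setminus[b_{v}-7,b_{v}-1]$. $J_{3}[v]$ is the set of integers $k$ for which there exist three $S(2,4,v)$ designs on a common point set with block sets $\mathcal{B}_1,\mathcal{B}_2,\mathcal{B}_3$ such that $\mathcal{B}_1\cap\mathcal{B}_2=\mathcal{B}_1\cap\mathcal{B}_3=\mathcal{B}_2\cap\mathcal{B}_3$ and this common set has exactly $k$ blocks. *)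

theory Defs
  imports Main
begin

definition S24_design :: "nat \<Rightarrow> 'a set \<Rightarrow> 'a set set \<Rightarrow> bool" where
  "S24_design v V B \<longleftrightarrow>
     finite V \<and> card V = v \<and>
     (\<forall>b\<in>B. b \<subseteq> V \<and> card b = 4) \<and>
     (\<forall>P. P \<subseteq> V \<and> card P = 2 \<longrightarrow> (\<exists>!b. b \<in> B \<and> P \<subseteq> b))"

(* The division is exact whenever an S(2,4,v) design exists (v = 1 or 4 mod 12). *)
definition num_blocks :: "nat \<Rightarrow> int" where
  "num_blocks v = int v * (int v - 1) div 12"

(* Integer intervals, so that the subtractions do not truncate for small v. *)
definition I3 :: "nat \<Rightarrow> int set" where
  "I3 v = {0..num_blocks v} - {num_blocks v - 7..num_blocks v - 1}"

(* Points are taken to be natural numbers; as point sets are finite and V is arbitrary,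
   this is no restriction up to isomorphism.
   The three designs need not be distinct. *)
definition J3 :: "nat \<Rightarrow> int set" where
  "J3 v = {k. \<exists>(V :: nat set) B1 B2 B3.
      S24_design v V B1 \<and> S24_design v V B2 \<and> S24_design v V B3 \<and>
      B1 \<inter> B2 = B1 \<inter> B3 \<and> B1 \<inter> B3 = B2 \<inter> B3 \<and>
      int (card (B1 \<inter> B2)) = k}"

end

(* Necessity: if three designs share exactly k blocks, removing these leaves three pairwise disjoint
   sets of m = 438 - k blocks that cover the same pairs. For 0 < m <= 7, each block b of the first set
   shares a triple with some block of the second and with some block of the third. If the two
   triples agree, two of their points have degree 2, which forces a repeated pair. If they differ,
   degree counting gives m = 7 and two points of degree 3 on every block, but then 2 * 7 incidences
   are distributed over points of degree 3.

   Sufficiency: the affine plane of order 5 without its origin is a group divisible design with 24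
   blocks of size 5 and 6 groups of size 4. Give each of its 24 points weight 3 and add a point at
   infinity: every block becomes a 4-GDD of type 3^5 and every group an S(2,4,13), and the
   triples of designs on these 30 parts can be chosen independently. Three 4-GDDs can share
   0, 1 or 15 blocks and three S(2,4,13) can share 0, ..., 5 or 13, and all k in question are sums
   of 24 and 6 such numbers. *)

theory Submission
  imports Defs
begin

subsection \<open>Three-way trades\<close>

definition deg :: "'a set set \<Rightarrow> 'a \<Rightarrow> nat" where
  "deg T x = card {b \<in> T. x \<in> b}"

definition linear_quads :: "'a set set \<Rightarrow> bool" where
  "linear_quads T \<longleftrightarrow> finite T \<and> (\<forall>b\<in>T. card b = 4) \<and>
     (\<forall>b\<in>T. \<forall>b'\<in>T. \<forall>x y. x \<noteq> y \<longrightarrow> {x, y} \<subseteq> b \<longrightarrow> {x, y} \<subseteq> b' \<longrightarrow> b = b')"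

lemma linear_quadsD:
  assumes "linear_quads T"
  shows "finite T" "b \<in> T \<Longrightarrow> card b = 4" "b \<in> T \<Longrightarrow> finite b"
    "b \<in> T \<Longrightarrow> b' \<in> T \<Longrightarrow> x \<noteq> y \<Longrightarrow> {x, y} \<subseteq> b \<Longrightarrow> {x, y} \<subseteq> b' \<Longrightarrow> b = b'"
  using assms unfolding linear_quads_def by (auto intro: card_ge_0_finite)

text \<open>Two blocks through \<open>x\<close> share no further point, so the sets
  \<open>b - {x}\<close> are disjoint triples.\<close>

lemma card_neighbours:
  assumes "linear_quads T"
  shows "card {y. y \<noteq> x \<and> (\<exists>b\<in>T. {x, y} \<subseteq> b)} = 3 * deg T x"
proof -
  note D = linear_quadsD[OF assms]
  have "{y. y \<noteq> x \<and> (\<exists>b\<in>T. {x, y} \<subseteq> b)} = (\<Union>b\<in>{b \<in> T. x \<in> b}. b - {x})"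
    by auto
  also have "card \<dots> = (\<Sum>b\<in>{b \<in> T. x \<in> b}. card (b - {x}))"
  proof (rule card_UN_disjoint)
    show "\<forall>b\<in>{b \<in> T. x \<in> b}. \<forall>b'\<in>{b \<in> T. x \<in> b}. b \<noteq> b' \<longrightarrow> (b - {x}) \<inter> (b' - {x}) = {}"
      using D(4) by blast
  qed (use D in auto)
  also have "\<dots> = (\<Sum>b\<in>{b \<in> T. x \<in> b}. 3)"
    using D by (intro sum.cong) auto
  finally show ?thesis
    by (simp add: deg_def)
qed

text \<open>A block other than \<open>b\<close> meets \<open>b\<close> in at most one point, so the
  other blocks through the points of \<open>b\<close> are counted without repetition; strictness
  comes from \<open>b\<close> itself.\<close>

lemma sum_deg_block:
  assumes "linear_quads T" and "b \<in> T"
  shows "(\<Sum>x\<in>b. deg T x - 1) < card T"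
proof -
  note D = linear_quadsD[OF assms(1)]
  have "(\<Sum>x\<in>b. deg T x - 1) = (\<Sum>x\<in>b. card ({b' \<in> T. x \<in> b'} - {b}))"
    unfolding deg_def using D(1) assms(2) by (intro sum.cong refl) auto
  also have "\<dots> = card (\<Union>x\<in>b. {b' \<in> T. x \<in> b'} - {b})"
  proof (rule card_UN_disjoint[symmetric])
    show "\<forall>x\<in>b. \<forall>y\<in>b. x \<noteq> y \<longrightarrow>
        ({b' \<in> T. x \<in> b'} - {b}) \<inter> ({b' \<in> T. y \<in> b'} - {b}) = {}"
      using D(4) assms(2) by blast
  qed (use D assms(2) in auto)
  also have "\<dots> \<le> card (T - {b})"
    using D(1) by (intro card_mono) auto
  also have "\<dots> < card T"
    using D(1) assms(2) by (rule card_Diff1_less)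
  finally show ?thesis .
qed

text \<open>The two halves of a Steiner trade with blocks of size 4: linearity lets each pair occur
  at most once per half, and \<open>cover\<close> says that the same pairs occur in both.\<close>

locale steiner_trade =
  fixes T U :: "'a set set"
  assumes lin: "linear_quads T" "linear_quads U"
    and disj: "T \<inter> U = {}"
    and cover: "x \<noteq> y \<Longrightarrow> (\<exists>b\<in>T. {x, y} \<subseteq> b) \<longleftrightarrow> (\<exists>b\<in>U. {x, y} \<subseteq> b)"
begin

text \<open>Both degrees are a third of the number of neighbours of \<open>x\<close>, and the
  neighbours depend only on the covered pairs.\<close>

lemma deg_eq: "deg T x = deg U x"
proof -
  have "{y. y \<noteq> x \<and> (\<exists>b\<in>T. {x, y} \<subseteq> b)} = {y. y \<noteq> x \<and> (\<exists>b\<in>U. {x, y} \<subseteq> b)}"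
    using cover[of x] by (intro Collect_cong) metis
  then show ?thesis
    using card_neighbours[OF lin(1), of x] card_neighbours[OF lin(2), of x] by simp
qed

lemma new_point:
  assumes "b \<in> T" "t \<in> U"
  obtains u where "u \<in> t" "u \<notin> b"
proof -
  have "t \<noteq> b"
    using disj assms by blast
  moreover have "t = b" if "t \<subseteq> b"
    using linear_quadsD[OF lin(1)] linear_quadsD[OF lin(2)] assms that by (metis card_subset_eq)
  ultimately show ?thesis
    using that by blast
qed

text \<open>A block \<open>t\<close> of \<open>U\<close> through \<open>x\<close> and another point
  of \<open>b\<close> has a point \<open>u\<close> outside \<open>b\<close>. The pair of
  \<open>x\<close> and \<open>u\<close> must be covered in \<open>T\<close> as well, by a second
  block through \<open>x\<close>.\<close>

lemma deg_ge_2: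
  assumes "b \<in> T" "x \<in> b"
  shows "2 \<le> deg T x"
proof -
  have "card (b - {x}) = 3"
    using linear_quadsD[OF lin(1)] assms by auto
  then obtain y where y: "y \<in> b" "y \<noteq> x"
    by (metis Diff_iff card.empty equals0I insertCI zero_neq_numeral)
  then obtain t where t: "t \<in> U" "{x, y} \<subseteq> t"
    using cover[of x y] assms by blast
  obtain u where u: "u \<in> t" "u \<notin> b"
    using new_point assms(1) t(1) by blast
  then obtain b' where b': "b' \<in> T" "{x, u} \<subseteq> b'"
    using cover[of x u] assms t by blast
  have "card {b, b'} \<le> deg T x"
    unfolding deg_def using linear_quadsD(1)[OF lin(1)] assms b' by (intro card_mono) auto
  moreover have "b \<noteq> b'"
    using u b' by auto
  ultimately show ?thesis
    by simp
qed

text \<open>The three pairs joining \<open>w\<close> to the rest of \<open>b\<close> are covered by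
  three different blocks of \<open>U\<close>: one block covering two of them would meet
  \<open>b\<close> in a triple. Hence \<open>w\<close> has degree at least 3 in \<open>U\<close>,
  and so in \<open>T\<close>.\<close>

lemma deg_ge_3:
  assumes b: "b \<in> T" "w \<in> b" and no_triple: "\<And>t. t \<in> U \<Longrightarrow> w \<in> t \<Longrightarrow> card (t \<inter> b) \<le> 2"
  shows "3 \<le> deg T w"
proof -
  have "\<exists>t\<in>U. {w, y} \<subseteq> t" if "y \<in> b - {w}" for y
    using cover[of w y] b that by blast
  then obtain f where f: "\<And>y. y \<in> b - {w} \<Longrightarrow> f y \<in> U \<and> {w, y} \<subseteq> f y"
    by metis
  have "inj_on f (b - {w})"
  proof (rule inj_onI, rule ccontr)
    fix y z assume yz: "y \<in> b - {w}" "z \<in> b - {w}" "f y = f z" "y \<noteq> z"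
    have "{w, y, z} \<subseteq> f y \<inter> b"
      using f[OF yz(1)] f[OF yz(2)] yz b by auto
    then have "card {w, y, z} \<le> card (f y \<inter> b)"
      using linear_quadsD(3)[OF lin(1) b(1)] by (intro card_mono) auto
    moreover have "card (f y \<inter> b) \<le> 2"
      using no_triple f[OF yz(1)] by blast
    ultimately show False
      using yz by auto
  qed
  then have "card (f ` (b - {w})) = 3"
    using linear_quadsD[OF lin(1)] b by (simp add: card_image)
  moreover have "card (f ` (b - {w})) \<le> deg U w"
    unfolding deg_def using f linear_quadsD(1)[OF lin(2)] by (intro card_mono) auto
  ultimately show ?thesis
    using deg_eq by simp
qed

text \<open>A block without a triple in the other half has four points of degree at least 3,
  which already forces nine blocks.\<close>

lemma triple_exists:
  assumes b: "b \<in> T" and small: "card T \<le> 7"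
  obtains t w where "t \<in> U" "w \<in> b" "t \<inter> b = b - {w}" "3 \<le> deg T w"
proof -
  note DT = linear_quadsD[OF lin(1)] and DU = linear_quadsD[OF lin(2)]
  have "\<exists>t\<in>U. 3 \<le> card (t \<inter> b)"
  proof (rule ccontr)
    assume neg: "\<not> ?thesis"
    have "card (t \<inter> b) \<le> 2" if "t \<in> U" for t
    proof -
      have "\<not> 3 \<le> card (t \<inter> b)"
        using neg that by blast
      then show ?thesis
        by simp
    qed
    then have ge3: "3 \<le> deg T x" if "x \<in> b" for x
      using deg_ge_3[OF b that] by simp
    have "2 \<le> deg T x - 1" if "x \<in> b" for x
      using ge3[OF that] by simp
    then have "(\<Sum>x\<in>b. 2) \<le> (\<Sum>x\<in>b. deg T x - 1)"
      by (rule sum_mono)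
    with sum_deg_block[OF lin(1) b] DT(2)[OF b] small show False
      by simp
  qed
  then obtain t where t: "t \<in> U" "3 \<le> card (t \<inter> b)"
    by blast
  obtain u where "u \<in> t" "u \<notin> b"
    using new_point b t(1) by blast
  then have "t \<inter> b \<subset> t"
    by blast
  then have "card (t \<inter> b) < 4"
    using psubset_card_mono[OF DU(3)[OF t(1)]] DU(2)[OF t(1)] by metis
  then have "card (b - t) = 1"
    using t DT(2,3)[OF b] card_Diff_subset_Int[of b t] by (simp add: Int_commute)
  then obtain w where w: "b - t = {w}"
    using card_1_singletonE by blast
  \<comment> \<open>If \<open>s\<close> met \<open>b\<close> in \<open>w\<close> and two more
    points, it would share those two points with \<open>t\<close> and so equal \<open>t\<close>,
    which misses \<open>w\<close>.\<close>
  have "card (s \<inter> b) \<le> 2" if s: "s \<in> U" "w \<in> s" for s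
  proof (rule ccontr)
    assume "\<not> card (s \<inter> b) \<le> 2"
    moreover have "card (s \<inter> b) = Suc (card (s \<inter> b - {w}))"
      using s w DT(3)[OF b] by (intro card.remove) auto
    ultimately have "\<not> card (s \<inter> b - {w}) \<le> Suc 0"
      by simp
    then obtain x y where xy: "x \<in> s \<inter> b - {w}" "y \<in> s \<inter> b - {w}" "x \<noteq> y"
      using card_le_Suc0_iff_eq[of "s \<inter> b - {w}"] DT(3)[OF b] by (meson finite_Diff finite_Int)
    moreover have "{x, y} \<subseteq> s" "{x, y} \<subseteq> t"
      using xy w by auto
    ultimately have "s = t"
      using DU(4)[OF s(1) t(1)] by blast
    then show False
      using s w by blast
  qed
  then have "3 \<le> deg T w"
    using b w by (intro deg_ge_3) auto
  then show thesis
    using that t(1) w by blast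
qed

end

text \<open>A local analysis at each block of \<open>T1\<close> fixes its degree pattern; a global
  count of incidences then contradicts that pattern.\<close>

lemma no_small_trade:
  assumes 12: "steiner_trade T1 T2" and 13: "steiner_trade T1 T3" and 23: "T2 \<inter> T3 = {}"
    and ne: "T1 \<noteq> {}" and small: "card T1 \<le> 7"
  shows False
proof -
  interpret t12: steiner_trade T1 T2 by (fact 12)
  interpret t13: steiner_trade T1 T3 by (fact 13)
  note D1 = linear_quadsD[OF t12.lin(1)]
  \<comment> \<open>The four numbers \<open>deg T1 x - 1\<close> on \<open>b\<close> are at least 1
    and add up to at most 6; those at the points \<open>w2\<close>, \<open>w3\<close> omitted by the
    two triples are at least 2. For \<open>w2 \<noteq> w3\<close> this leaves only the values 2, 2,
    1, 1, with \<open>card T1 = 7\<close>.\<close>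
  have key: "card T1 = 7 \<and> (\<forall>x\<in>b. deg T1 x \<le> 3) \<and> card {x\<in>b. deg T1 x = 3} = 2" if b: "b \<in> T1" for b
  proof -
    obtain t2 w2 where t2: "t2 \<in> T2" "w2 \<in> b" "t2 \<inter> b = b - {w2}" "3 \<le> deg T1 w2"
      using t12.triple_exists[OF b small] .
    obtain t3 w3 where t3: "t3 \<in> T3" "w3 \<in> b" "t3 \<inter> b = b - {w3}" "3 \<le> deg T1 w3"
      using t13.triple_exists[OF b small] .
    have ge2: "\<And>x. x \<in> b \<Longrightarrow> 2 \<le> deg T1 x"
      using t12.deg_ge_2[OF b] .
    have finb: "finite b" and cardb: "card b = 4"
      using D1(2,3)[OF b] by simp_all
    have sum6: "(\<Sum>x\<in>b. deg T1 x - 1) < card T1"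
      using sum_deg_block[OF t12.lin(1) b] .
    have "w2 \<noteq> w3"
    proof
      assume eq: "w2 = w3"
      obtain p q r where pqr: "b - {w2} = {p, q, r}" "p \<noteq> q" "p \<noteq> r" "q \<noteq> r"
        using card_3_iff[of "b - {w2}"] cardb finb t2(2) by auto
      have "b = {w2, p, q, r}"
        using pqr t2(2) by blast
      moreover have "w2 \<notin> {p, q, r}"
        using pqr by blast
      ultimately have "(\<Sum>x\<in>b. deg T1 x - 1) =
          (deg T1 w2 - 1) + (deg T1 p - 1) + (deg T1 q - 1) + (deg T1 r - 1)"
        using pqr by simp
      moreover have "2 \<le> deg T1 p" "2 \<le> deg T1 q" "2 \<le> deg T1 r"
        using pqr ge2 by auto
      \<comment> \<open>The omitted point takes at least 2 of the total 6, so the other three share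
        at most 4 and two of them contribute just 1.\<close>
      ultimately have "deg T1 p = 2 \<and> deg T1 q = 2 \<or> deg T1 p = 2 \<and> deg T1 r = 2 \<or> deg T1 q = 2 \<and> deg T1 r = 2"
        using sum6 small t2(4) by linarith
      then obtain x y where xy: "x \<in> b - {w2}" "y \<in> b - {w2}" "x \<noteq> y" "deg T1 x = 2" "deg T1 y = 2"
        using pqr by auto
      obtain a where a: "a \<in> t2" "a \<notin> b"
        using t12.new_point b t2(1) by blast
      obtain c where c: "c \<in> t3" "c \<notin> b"
        using t13.new_point b t3(1) by blast
      have xyt: "{x, y} \<subseteq> t2" "{x, y} \<subseteq> t3"
        using xy t2(3) t3(3) eq by blast+
      \<comment> \<open>With equal fourth points \<open>t2\<close> and \<open>t3\<close> would be
        the same block, against the disjointness of \<open>T2\<close> and \<open>T3\<close>.\<close>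
      have "a \<noteq> c"
      proof
        assume "a = c"
        have "t2 = insert a (b - {w2})"
          using t2 a linear_quadsD(2,3)[OF t12.lin(2) t2(1)] cardb finb
          by (intro card_subset_eq[symmetric]) auto
        moreover have "t3 = insert c (b - {w3})"
          using t3 c linear_quadsD(2,3)[OF t13.lin(2) t3(1)] cardb finb
          by (intro card_subset_eq[symmetric]) auto
        ultimately show False
          using \<open>a = c\<close> eq t2(1) t3(1) 23 by auto
      qed
      \<comment> \<open>Besides \<open>b\<close> only one block of \<open>T1\<close> passes through
        \<open>z\<close>, and it has to cover both the pair with \<open>a\<close> and the pair with
        \<open>c\<close>.\<close>
      have other: "\<exists>d\<in>T1. {z, a, c} \<subseteq> d" if z: "z \<in> b" "z \<in> t2" "z \<in> t3" "deg T1 z = 2" for z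
      proof -
        obtain d where d: "d \<in> T1" "{z, a} \<subseteq> d"
          using t12.cover[of z a] z a t2(1) by blast
        obtain e where e: "e \<in> T1" "{z, c} \<subseteq> e"
          using t13.cover[of z c] z c t3(1) by blast
        have "d = e"
        proof (rule ccontr)
          assume "d \<noteq> e"
          moreover have "b \<noteq> d" "b \<noteq> e"
            using a c d e by auto
          ultimately have "card {b, d, e} = 3"
            by simp
          moreover have "card {b, d, e} \<le> deg T1 z"
            unfolding deg_def using b d e z D1(1) by (intro card_mono) auto
          ultimately show False
            using z(4) by simp
        qed
        then show ?thesis
          using d e by blast
      qed
      obtain d where d: "d \<in> T1" "{x, a, c} \<subseteq> d"
        using other[of x] xy xyt by blast
      obtain e where e: "e \<in> T1" "{y, a, c} \<subseteq> e"
        using other[of y] xy xyt by blast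
      \<comment> \<open>The pair of \<open>a\<close> and \<open>c\<close> identifies the two blocks;
        the result contains \<open>x\<close> and \<open>y\<close>, hence is \<open>b\<close>,
        although \<open>a\<close> lies outside \<open>b\<close>.\<close>
      have "d = e"
        using D1(4)[OF d(1) e(1) \<open>a \<noteq> c\<close>] d e by blast
      then have "d = b"
        using D1(4)[OF d(1) b xy(3)] d e xy by blast
      then show False
        using d a by blast
    qed
    have "card (b - {w2, w3}) = 2"
      using t2(2) t3(2) \<open>w2 \<noteq> w3\<close> cardb finb by (simp add: card_Diff_subset)
    then obtain x y where xy: "b - {w2, w3} = {x, y}" "x \<noteq> y"
      by (meson card_2_iff)
    then have bxy: "b = {w2, w3, x, y}" and new: "w2 \<notin> {x, y}" "w3 \<notin> {x, y}"
      using t2(2) t3(2) by blast+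
    have "(\<Sum>x\<in>b. deg T1 x - 1) = (deg T1 w2 - 1) + (deg T1 w3 - 1) + (deg T1 x - 1) + (deg T1 y - 1)"
      unfolding bxy using new xy(2) \<open>w2 \<noteq> w3\<close> by simp
    moreover have "2 \<le> deg T1 x" "2 \<le> deg T1 y"
      using ge2 bxy by auto
    ultimately have *: "card T1 = 7" "deg T1 w2 = 3" "deg T1 w3 = 3" "deg T1 x = 2" "deg T1 y = 2"
      using sum6 small t2(4) t3(4) by linarith+
    have "{x\<in>b. deg T1 x = 3} = {w2, w3}"
      unfolding bxy using * by auto
    then show ?thesis
      unfolding bxy using * \<open>w2 \<noteq> w3\<close> by auto
  qed
  \<comment> \<open>Incidences between \<open>S\<close> and \<open>T1\<close>: two on each of 7
    blocks, three at each point of \<open>S\<close>, but 14 is not a multiple of 3.\<close>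
  define S where "S = {x \<in> \<Union>T1. deg T1 x = 3}"
  have "finite S"
    using D1 unfolding S_def by auto
  moreover have "card {x \<in> S. x \<in> b} = 2" if "b \<in> T1" for b
  proof -
    have "{x \<in> S. x \<in> b} = {x\<in>b. deg T1 x = 3}"
      using that by (auto simp: S_def)
    then show ?thesis
      using key[OF that] by simp
  qed
  ultimately have "(\<Sum>x\<in>S. card {b \<in> T1. x \<in> b}) = 2 * card T1"
    using D1(1) by (intro sum_multicount) auto
  moreover have "(\<Sum>x\<in>S. card {b \<in> T1. x \<in> b}) = 3 * card S"
    by (subst sum.cong[of S S _ "\<lambda>_. 3"]) (auto simp: S_def deg_def)
  moreover have "card T1 = 7"
    using key ne by blast
  ultimately have "3 * card S = 14"
    by simp
  then show False
    by presburger
qed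

subsection \<open>Decompositions of graphs into complete graphs on four vertices\<close>

definition pairs_in :: "'a set \<Rightarrow> 'a set set" where
  "pairs_in S = {P. P \<subseteq> S \<and> card P = 2}"

text \<open>An arbitrary edge set treats designs and GDDs alike: the complete graph gives an
  S(2,4,v), the complete multipartite graph with \<open>n\<close> classes of size 3 gives a 4-GDD of
  type 3^n.\<close>

definition decomposes :: "'a set set \<Rightarrow> 'a set set \<Rightarrow> bool" where
  "decomposes B E \<longleftrightarrow> finite B \<and> (\<forall>P\<in>E. card P = 2) \<and>
     (\<forall>b\<in>B. card b = 4 \<and> pairs_in b \<subseteq> E) \<and> (\<forall>P\<in>E. \<exists>!b. b \<in> B \<and> P \<subseteq> b)"

definition three_way :: "'a set set \<Rightarrow> nat \<Rightarrow> bool" where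
  "three_way E k \<longleftrightarrow> (\<exists>B1 B2 B3. decomposes B1 E \<and> decomposes B2 E \<and> decomposes B3 E \<and>
     B1 \<inter> B2 = B1 \<inter> B3 \<and> B1 \<inter> B3 = B2 \<inter> B3 \<and> card (B1 \<inter> B2) = k)"

lemma three_wayI:
  assumes "decomposes B1 E" "decomposes B2 E" "decomposes B3 E"
    "B1 \<inter> B2 = B1 \<inter> B3" "B1 \<inter> B3 = B2 \<inter> B3" "card (B1 \<inter> B2) = k"
  shows "three_way E k"
  unfolding three_way_def using assms by (intro exI conjI)

lemma Union_pairs_in:
  assumes "2 \<le> card b"
  shows "\<Union>(pairs_in b) = b"
proof
  show "b \<subseteq> \<Union>(pairs_in b)"
  proof
    fix x assume x: "x \<in> b"
    have "\<exists>y\<in>b. y \<noteq> x"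
    proof (rule ccontr)
      assume "\<not> ?thesis"
      then have "b = {x}"
        using x by blast
      with assms show False
        by simp
    qed
    then obtain y where "y \<in> b" "y \<noteq> x"
      by blast
    then have "{x, y} \<in> pairs_in b"
      using x by (simp add: pairs_in_def)
    then show "x \<in> \<Union>(pairs_in b)"
      by blast
  qed
qed (auto simp: pairs_in_def)

lemma decomposesD:
  assumes "decomposes B E"
  shows "finite B" "P \<in> E \<Longrightarrow> card P = 2" "b \<in> B \<Longrightarrow> card b = 4"
    "b \<in> B \<Longrightarrow> P \<subseteq> b \<Longrightarrow> card P = 2 \<Longrightarrow> P \<in> E" "P \<in> E \<Longrightarrow> \<exists>b\<in>B. P \<subseteq> b"
    "P \<in> E \<Longrightarrow> b \<in> B \<Longrightarrow> b' \<in> B \<Longrightarrow> P \<subseteq> b \<Longrightarrow> P \<subseteq> b' \<Longrightarrow> b = b'"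
proof -
  note D = assms[unfolded decomposes_def]
  show "finite B" "P \<in> E \<Longrightarrow> card P = 2" "b \<in> B \<Longrightarrow> card b = 4"
    using D by auto
  show "\<exists>b\<in>B. P \<subseteq> b" if "P \<in> E"
    using D that by meson
  show "P \<in> E" if "b \<in> B" "P \<subseteq> b" "card P = 2"
    using D that unfolding pairs_in_def by blast
  show "b = b'" if "P \<in> E" "b \<in> B" "b' \<in> B" "P \<subseteq> b" "P \<subseteq> b'"
  proof -
    have "\<exists>!b. b \<in> B \<and> P \<subseteq> b"
      using D that(1) by simp
    then show ?thesis
      using that(2-5) by (elim ex1E) metis
  qed
qed

lemma decomposesI:
  assumes "finite B" "\<And>P. P \<in> E \<Longrightarrow> card P = 2" "\<And>b. b \<in> B \<Longrightarrow> card b = 4"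
    "\<And>b P. b \<in> B \<Longrightarrow> P \<subseteq> b \<Longrightarrow> card P = 2 \<Longrightarrow> P \<in> E" "\<And>P. P \<in> E \<Longrightarrow> \<exists>b\<in>B. P \<subseteq> b"
    "\<And>P b b'. P \<in> E \<Longrightarrow> b \<in> B \<Longrightarrow> b' \<in> B \<Longrightarrow> P \<subseteq> b \<Longrightarrow> P \<subseteq> b' \<Longrightarrow> b = b'"
  shows "decomposes B E"
  unfolding decomposes_def pairs_in_def
proof (intro conjI ballI)
  fix P assume P: "P \<in> E"
  then obtain b where "b \<in> B" "P \<subseteq> b"
    using assms(5) by blast
  then show "\<exists>!b. b \<in> B \<and> P \<subseteq> b"
    using assms(6)[OF P] by (intro ex1I[of _ b]) auto
qed (use assms(1-4) in auto)

lemma decomposes_block_subset: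
  assumes "decomposes B E" "b \<in> B"
  shows "b \<subseteq> \<Union>E"
proof -
  have "card b = 4" "pairs_in b \<subseteq> E"
    using assms by (auto simp: decomposes_def)
  then show ?thesis
    using Union_pairs_in[of b] Union_mono[of "pairs_in b" E] by simp
qed

lemma S24_design_iff_decomposes:
  "S24_design v V B \<longleftrightarrow> finite V \<and> card V = v \<and> decomposes B (pairs_in V)"
proof
  assume S: "S24_design v V B"
  then have "B \<subseteq> Pow V" "finite V"
    by (auto simp: S24_design_def)
  then have "finite B"
    using finite_subset by blast
  moreover have "pairs_in b \<subseteq> pairs_in V" if "b \<in> B" for b
    using \<open>B \<subseteq> Pow V\<close> that by (auto simp: pairs_in_def)
  ultimately show "finite V \<and> card V = v \<and> decomposes B (pairs_in V)"
    using S unfolding S24_design_def decomposes_def by (simp add: pairs_in_def)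
next
  assume R: "finite V \<and> card V = v \<and> decomposes B (pairs_in V)"
  have "b \<subseteq> V" if "b \<in> B" for b
    using decomposes_block_subset[of B "pairs_in V" b] R that by (auto simp: pairs_in_def)
  then show "S24_design v V B"
    using R unfolding S24_design_def decomposes_def by (simp add: pairs_in_def)
qed

text \<open>A common block would have its pairs in both edge sets.\<close>

lemma decomposes_disjoint:
  assumes B: "decomposes B E" and C: "decomposes C F" and EF: "E \<inter> F = {}"
  shows "B \<inter> C = {}"
proof (rule ccontr)
  assume "B \<inter> C \<noteq> {}"
  then obtain b where b: "b \<in> B" "b \<in> C"
    by blast
  obtain P where "P \<subseteq> b" "card P = 2"
    using obtain_subset_with_card_n[of 2 b] decomposesD(3)[OF B b(1)] by auto
  then have "P \<in> E \<inter> F"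
    using b decomposesD(4)[OF B] decomposesD(4)[OF C] by blast
  with EF show False
    by blast
qed

lemma decomposes_Un:
  assumes B: "decomposes B E" and C: "decomposes C F" and EF: "E \<inter> F = {}"
  shows "decomposes (B \<union> C) (E \<union> F)"
proof (rule decomposesI)
  fix P b b' assume P: "P \<in> E \<union> F" and b: "b \<in> B \<union> C" "b' \<in> B \<union> C" "P \<subseteq> b" "P \<subseteq> b'"
  have "card P = 2"
    using P decomposesD(2)[OF B] decomposesD(2)[OF C] by blast
  then have "P \<in> E \<and> b \<in> B \<and> b' \<in> B \<or> P \<in> F \<and> b \<in> C \<and> b' \<in> C"
    using b EF decomposesD(4)[OF B] decomposesD(4)[OF C] by blast
  then show "b = b'"
    using b(3,4) decomposesD(6)[OF B] decomposesD(6)[OF C] by metis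
next
  show "finite (B \<union> C)"
    using decomposesD(1)[OF B] decomposesD(1)[OF C] by simp
next
  fix P assume "P \<in> E \<union> F"
  then show "card P = 2" "\<exists>b\<in>B \<union> C. P \<subseteq> b"
    using decomposesD(2,5)[OF B] decomposesD(2,5)[OF C] by (metis Un_iff)+
next
  fix b assume b: "b \<in> B \<union> C"
  then show "card b = 4"
    using decomposesD(3)[OF B] decomposesD(3)[OF C] by blast
  show "P \<in> E \<union> F" if "P \<subseteq> b" "card P = 2" for P
    using b that decomposesD(4)[OF B] decomposesD(4)[OF C] by (metis Un_iff)
qed

text \<open>Blocks from different parts never coincide, so pairwise intersections are formed part by
  part and their sizes add.\<close>

lemma three_way_Un:
  assumes "three_way E k" "three_way F l" and EF: "E \<inter> F = {}"
  shows "three_way (E \<union> F) (k + l)"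
proof -
  obtain B1 B2 B3 where B: "decomposes B1 E" "decomposes B2 E" "decomposes B3 E"
    "B1 \<inter> B2 = B1 \<inter> B3" "B1 \<inter> B3 = B2 \<inter> B3" "card (B1 \<inter> B2) = k"
    using assms(1) unfolding three_way_def by blast
  obtain C1 C2 C3 where C: "decomposes C1 F" "decomposes C2 F" "decomposes C3 F"
    "C1 \<inter> C2 = C1 \<inter> C3" "C1 \<inter> C3 = C2 \<inter> C3" "card (C1 \<inter> C2) = l"
    using assms(2) unfolding three_way_def by blast
  have Int: "(B \<union> C) \<inter> (B' \<union> C') = B \<inter> B' \<union> C \<inter> C'"
    if "decomposes B E" "decomposes B' E" "decomposes C F" "decomposes C' F" for B B' C C'
    using decomposes_disjoint[OF that(1,4) EF] decomposes_disjoint[OF that(2,3) EF] by blast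
  have "card (B1 \<inter> B2 \<union> C1 \<inter> C2) = k + l"
    using B(6) C(6) decomposes_disjoint[OF B(1) C(1) EF] decomposesD(1)[OF B(1)] decomposesD(1)[OF C(1)]
    by (subst card_Un_disjoint) auto
  then have "card ((B1 \<union> C1) \<inter> (B2 \<union> C2)) = k + l"
    using Int B(1,2) C(1,2) by simp
  show ?thesis
  proof (rule three_wayI)
    show "card ((B1 \<union> C1) \<inter> (B2 \<union> C2)) = k + l" by fact
    show "(B1 \<union> C1) \<inter> (B2 \<union> C2) = (B1 \<union> C1) \<inter> (B3 \<union> C3)"
      "(B1 \<union> C1) \<inter> (B3 \<union> C3) = (B2 \<union> C2) \<inter> (B3 \<union> C3)"
      using Int B(1-5) C(1-5) by simp_all
  qed (intro decomposes_Un B C EF)+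
qed

text \<open>Every part admits every entry of \<open>ks\<close>, so it does not matter which part
  receives which entry and a plain list suffices.\<close>

lemma three_way_UN:
  assumes "finite I" and "length ks = card I" and "\<And>i k. i \<in> I \<Longrightarrow> k \<in> set ks \<Longrightarrow> three_way (E i) k"
    and "\<And>i j. i \<in> I \<Longrightarrow> j \<in> I \<Longrightarrow> i \<noteq> j \<Longrightarrow> E i \<inter> E j = {}"
  shows "three_way (\<Union>i\<in>I. E i) (sum_list ks)"
  using assms
proof (induction I arbitrary: ks rule: finite_induct)
  case empty
  have "decomposes {} {}"
    by (simp add: decomposes_def)
  then have "three_way {} 0"
    using three_wayI[of "{}" "{}" "{}" "{}" 0] by simp
  with empty show ?case
    by simp
next
  case (insert i I)
  then obtain k ls where ks: "ks = k # ls" "length ls = card I"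
    by (cases ks) auto
  have "three_way (\<Union>i\<in>I. E i) (sum_list ls)"
    using insert.prems ks by (intro insert.IH) auto
  moreover have "three_way (E i) k"
    using insert.prems(2) ks by simp
  moreover have "E i \<inter> (\<Union>i\<in>I. E i) = {}"
    using insert.prems(3)[of i] insert.hyps(2) by blast
  ultimately have "three_way (E i \<union> (\<Union>i\<in>I. E i)) (k + sum_list ls)"
    using three_way_Un by metis
  then show ?case
    by (simp add: ks(1))
qed

lemma decomposes_image:
  assumes B: "decomposes B E" and inj: "inj_on f (\<Union>E)"
  shows "decomposes ((`) f ` B) ((`) f ` E)"
proof (rule decomposesI)
  note sub = decomposes_block_subset[OF B]
  show "finite ((`) f ` B)"
    using decomposesD(1)[OF B] by simp
  show "card P = 2" if P: "P \<in> (`) f ` E" for P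
  proof -
    obtain Q where "Q \<in> E" "P = f ` Q"
      using P by blast
    then show ?thesis
      using decomposesD(2)[OF B] inj by (metis Union_upper card_image inj_on_subset)
  qed
  show "card b = 4" if b: "b \<in> (`) f ` B" for b
  proof -
    obtain c where "c \<in> B" "b = f ` c"
      using b by blast
    then show ?thesis
      using decomposesD(3)[OF B] inj sub by (metis card_image inj_on_subset)
  qed
  show "P \<in> (`) f ` E" if b: "b \<in> (`) f ` B" and P: "P \<subseteq> b" "card P = 2" for b P
  proof -
    obtain c where c: "c \<in> B" "b = f ` c"
      using b by blast
    then obtain Q where Q: "Q \<subseteq> c" "P = f ` Q"
      using P(1) by (meson subset_imageE)
    then have "card Q = 2"
      using P(2) inj sub[OF c(1)] by (metis card_image inj_on_subset)
    then show ?thesis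
      using decomposesD(4)[OF B c(1) Q(1)] Q(2) by blast
  qed
  show "\<exists>b\<in>(`) f ` B. P \<subseteq> b" if P: "P \<in> (`) f ` E" for P
  proof -
    obtain Q where "Q \<in> E" "P = f ` Q"
      using P by blast
    then show ?thesis
      using decomposesD(5)[OF B \<open>Q \<in> E\<close>] by (auto intro: image_mono)
  qed
  show "b = b'" if P: "P \<in> (`) f ` E" and b: "b \<in> (`) f ` B" "b' \<in> (`) f ` B" "P \<subseteq> b" "P \<subseteq> b'" for P b b'
  proof -
    obtain Q c c' where Q: "Q \<in> E" "P = f ` Q" and c: "c \<in> B" "b = f ` c" and c': "c' \<in> B" "b' = f ` c'"
      using P b by blast
    have "Q \<subseteq> d" if "d \<in> B" "f ` Q \<subseteq> f ` d" for d
    proof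
      fix x assume x: "x \<in> Q"
      then obtain y where "y \<in> d" "f x = f y"
        using \<open>f ` Q \<subseteq> f ` d\<close> by blast
      moreover have "x \<in> \<Union>E" "y \<in> \<Union>E"
        using x Q(1) \<open>y \<in> d\<close> sub[OF \<open>d \<in> B\<close>] by blast+
      ultimately show "x \<in> d"
        using inj by (metis inj_onD)
    qed
    then have "Q \<subseteq> c" "Q \<subseteq> c'"
      using b(3,4) Q(2) c c' by blast+
    then show ?thesis
      using decomposesD(6)[OF B Q(1) c(1) c'(1)] c c' by simp
  qed
qed

lemma three_way_image:
  assumes "three_way E k" and inj: "inj_on f (\<Union>E)"
  shows "three_way ((`) f ` E) k"
proof -
  obtain B1 B2 B3 where B: "decomposes B1 E" "decomposes B2 E" "decomposes B3 E"
    "B1 \<inter> B2 = B1 \<inter> B3" "B1 \<inter> B3 = B2 \<inter> B3" "card (B1 \<inter> B2) = k"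
    using assms(1) unfolding three_way_def by blast
  have sub: "C \<subseteq> Pow (\<Union>E)" if "decomposes C E" for C
    using decomposes_block_subset[OF that] by blast
  have inj': "inj_on ((`) f) (Pow (\<Union>E))"
    using inj by (rule inj_on_image_Pow)
  have Int: "(`) f ` C \<inter> (`) f ` D = (`) f ` (C \<inter> D)" if "decomposes C E" "decomposes D E" for C D
    using inj_on_image_Int[OF inj' sub[OF that(1)] sub[OF that(2)]] by simp
  have "card ((`) f ` (B1 \<inter> B2)) = k"
    using B(6) sub[OF B(1)] inj' by (metis card_image inj_on_subset le_infI1)
  then have "card ((`) f ` B1 \<inter> (`) f ` B2) = k"
    using Int[OF B(1,2)] by simp
  moreover have "(`) f ` B1 \<inter> (`) f ` B2 = (`) f ` B1 \<inter> (`) f ` B3"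
    "(`) f ` B1 \<inter> (`) f ` B3 = (`) f ` B2 \<inter> (`) f ` B3"
    using Int B by simp_all
  ultimately show ?thesis
    using three_wayI decomposes_image[OF _ inj] B(1-3) by metis
qed

section \<open>Checking explicit block lists by evaluation\<close>

lemma distinct_concat_map_unique:
  assumes "distinct (concat (map f xs))" "x \<in> set xs" "y \<in> set xs" "z \<in> set (f x)" "z \<in> set (f y)"
  shows "x = y"
  using assms by (induction xs) auto

lemma pairs_in_doubleton:
  assumes "P \<in> pairs_in S"
  obtains x y where "x \<in> S" "y \<in> S" "x \<noteq> y" "P = {x, y}"
  using assms by (auto simp: pairs_in_def card_2_iff)

definition neighbours :: "nat list list \<Rightarrow> nat \<Rightarrow> nat list" where
  "neighbours bs x = concat (map (removeAll x) (filter (\<lambda>b. x \<in> set b) bs))"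

text \<open>One list equation per point states that each neighbour of \<open>x\<close> is met
  exactly once and nothing else is met. Increasing blocks make equality of lists agree with equality
  of sets. The block size is left open, so that lines and groups of the plane can be checked
  together.\<close>

definition block_list :: "nat \<Rightarrow> (nat \<Rightarrow> nat \<Rightarrow> bool) \<Rightarrow> nat list list \<Rightarrow> bool" where
  "block_list n adj bs \<longleftrightarrow> distinct bs \<and>
     list_all (\<lambda>b. sorted_wrt (<) b \<and> list_all (\<lambda>x. x < n) b) bs \<and>
     list_all (\<lambda>x. sort (neighbours bs x) = filter (adj x) [0..<n]) [0..<n]"

definition graph_edges :: "nat \<Rightarrow> (nat \<Rightarrow> nat \<Rightarrow> bool) \<Rightarrow> nat set set" where
  "graph_edges n adj = {{x, y} | x y. x < n \<and> y < n \<and> adj x y}"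

lemma set_neighbours: "set (neighbours bs x) = {y. y \<noteq> x \<and> (\<exists>b\<in>set bs. x \<in> set b \<and> y \<in> set b)}"
  by (auto simp: neighbours_def)

lemma block_listD:
  assumes bs: "block_list n adj bs"
  shows "distinct bs"
    and "b \<in> set bs \<Longrightarrow> sorted_wrt (<) b"
    and "b \<in> set bs \<Longrightarrow> set b \<subseteq> {..<n}"
    and "b \<in> set bs \<Longrightarrow> x \<in> set b \<Longrightarrow> y \<in> set b \<Longrightarrow> x \<noteq> y \<Longrightarrow> adj x y"
    and "x < n \<Longrightarrow> y < n \<Longrightarrow> adj x y \<Longrightarrow> x \<noteq> y \<and> (\<exists>b\<in>set bs. x \<in> set b \<and> y \<in> set b)"
    and "b \<in> set bs \<Longrightarrow> b' \<in> set bs \<Longrightarrow> {x, y} \<subseteq> set b \<Longrightarrow> {x, y} \<subseteq> set b' \<Longrightarrow> x \<noteq> y \<Longrightarrow> b = b'"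
proof -
  show "distinct bs" and "b \<in> set bs \<Longrightarrow> sorted_wrt (<) b" for b
    using bs by (auto simp: block_list_def list_all_iff)
  show sub: "set b \<subseteq> {..<n}" if "b \<in> set bs" for b
    using bs that by (auto simp: block_list_def list_all_iff)
  have nb: "sort (neighbours bs x) = filter (adj x) [0..<n]" if "x < n" for x
    using bs that by (auto simp: block_list_def list_all_iff)
  \<comment> \<open>Taking \<open>set\<close> of the equation yields which pairs are covered; taking
    \<open>distinct\<close> yields that none is covered twice.\<close>
  then have set_nb: "set (neighbours bs x) = {y. y < n \<and> adj x y}" if "x < n" for x
    using arg_cong[OF nb[OF that], of set] by auto
  have dist: "distinct (neighbours bs x)" if "x < n" for x
    using arg_cong[OF nb[OF that], of distinct] by simp
  show "adj x y" if "b \<in> set bs" "x \<in> set b" "y \<in> set b" "x \<noteq> y"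
  proof -
    have "x < n"
      using sub that by blast
    moreover have "y \<in> set (neighbours bs x)"
      unfolding set_neighbours using that by blast
    ultimately show ?thesis
      using set_nb by blast
  qed
  show "x \<noteq> y \<and> (\<exists>b\<in>set bs. x \<in> set b \<and> y \<in> set b)" if "x < n" "y < n" "adj x y"
  proof -
    have "y \<in> set (neighbours bs x)"
      using set_nb that by blast
    then show ?thesis
      unfolding set_neighbours by blast
  qed
  show "b = b'" if b: "b \<in> set bs" "b' \<in> set bs" "{x, y} \<subseteq> set b" "{x, y} \<subseteq> set b'" "x \<noteq> y"
  proof -
    have "x < n"
      using sub b by blast
    then show ?thesis
      using dist[unfolded neighbours_def] b
      by (intro distinct_concat_map_unique[of "removeAll x" "filter (\<lambda>b. x \<in> set b) bs" b b' y]) auto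
  qed
qed

lemma block_list_decomposes:
  assumes bs: "block_list n adj bs" and len: "list_all (\<lambda>b. length b = 4) bs"
  shows "decomposes (set ` set bs) (graph_edges n adj)"
proof (rule decomposesI)
  note D = block_listD[OF bs]
  have edge: "\<exists>x y. P = {x, y} \<and> x < n \<and> y < n \<and> adj x y \<and> x \<noteq> y" if "P \<in> graph_edges n adj" for P
  proof -
    obtain x y where "P = {x, y}" "x < n" "y < n" "adj x y"
      using \<open>P \<in> graph_edges n adj\<close> by (auto simp: graph_edges_def)
    then show ?thesis
      using D(5) by blast
  qed
  show "finite (set ` set bs)"
    by simp
  show "card P = 2" if "P \<in> graph_edges n adj" for P
    using edge[OF that] by auto
  show "card b = 4" if "b \<in> set ` set bs" for b
    using that len D(2) by (auto simp: distinct_card strict_sorted_iff list_all_iff)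
  show "P \<in> graph_edges n adj" if b: "b \<in> set ` set bs" and P: "P \<subseteq> b" "card P = 2" for b P
  proof -
    obtain c where c: "c \<in> set bs" "b = set c"
      using b by blast
    have "P \<in> pairs_in (set c)"
      using P c by (simp add: pairs_in_def)
    then obtain x y where xy: "x \<in> set c" "y \<in> set c" "x \<noteq> y" "P = {x, y}"
      by (rule pairs_in_doubleton)
    moreover have "adj x y" "x < n" "y < n"
      using D(4)[OF c(1) xy(1-3)] D(3)[OF c(1)] xy by auto
    ultimately show ?thesis
      unfolding graph_edges_def by blast
  qed
  show "\<exists>b\<in>set ` set bs. P \<subseteq> b" if P: "P \<in> graph_edges n adj" for P
  proof -
    obtain x y where xy: "P = {x, y}" "x < n" "y < n" "adj x y"
      using edge[OF P] by blast
    then obtain b where "b \<in> set bs" "x \<in> set b" "y \<in> set b"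
      using D(5) by blast
    then show ?thesis
      using xy(1) by (intro bexI[of _ "set b"]) auto
  qed
  show "b = b'" if P: "P \<in> graph_edges n adj" and b: "b \<in> set ` set bs" "b' \<in> set ` set bs" "P \<subseteq> b" "P \<subseteq> b'"
    for P b b'
  proof -
    obtain x y where xy: "P = {x, y}" "x \<noteq> y"
      using edge[OF P] by blast
    obtain c c' where c: "c \<in> set bs" "b = set c" "c' \<in> set bs" "b' = set c'"
      using b(1,2) by auto
    then have "c = c'"
      using D(6)[OF c(1,3) _ _ xy(2)] b(3,4) xy(1) by blast
    then show ?thesis
      using c by simp
  qed
qed

text \<open>The common blocks are compared as lists, including their order; this works because all
  block lists supplied below are in lexicographic order.\<close>

definition three_way_lists ::
  "nat \<Rightarrow> (nat \<Rightarrow> nat \<Rightarrow> bool) \<Rightarrow> nat list list \<Rightarrow> nat list list \<Rightarrow> nat list list \<Rightarrow> nat \<Rightarrow> bool" where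
  "three_way_lists n adj xs ys zs k \<longleftrightarrow>
     list_all (\<lambda>bs. block_list n adj bs \<and> list_all (\<lambda>b. length b = 4) bs) [xs, ys, zs] \<and>
     filter (\<lambda>b. b \<in> set ys) xs = filter (\<lambda>b. b \<in> set zs) xs \<and>
     filter (\<lambda>b. b \<in> set zs) xs = filter (\<lambda>b. b \<in> set zs) ys \<and>
     length (filter (\<lambda>b. b \<in> set ys) xs) = k"

lemma three_way_lists:
  assumes "three_way_lists n adj xs ys zs k"
  shows "three_way (graph_edges n adj) k"
proof -
  have d: "block_list n adj xs" "block_list n adj ys" "block_list n adj zs"
    and len: "list_all (\<lambda>b. length b = 4) xs" "list_all (\<lambda>b. length b = 4) ys" "list_all (\<lambda>b. length b = 4) zs"
    and f: "filter (\<lambda>b. b \<in> set ys) xs = filter (\<lambda>b. b \<in> set zs) xs"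
      "filter (\<lambda>b. b \<in> set zs) xs = filter (\<lambda>b. b \<in> set zs) ys"
      "length (filter (\<lambda>b. b \<in> set ys) xs) = k"
    using assms by (auto simp: three_way_lists_def)
  have sorted: "set bs \<subseteq> {b. sorted_wrt (<) b}" if "block_list n adj bs" for bs
    using block_listD(2)[OF that] by blast
  \<comment> \<open>A strictly increasing list is determined by its set, so intersections of block
    sets can be computed on the lists.\<close>
  have inj: "inj_on set {b :: nat list. sorted_wrt (<) b}"
    by (auto intro!: inj_onI simp: strict_sorted_equal)
  have Int: "set ` set as \<inter> set ` set bs = set ` set (filter (\<lambda>b. b \<in> set bs) as)"
    if "block_list n adj as" "block_list n adj bs" for as bs
    using inj_on_image_Int[OF inj sorted[OF that(1)] sorted[OF that(2)]] by (auto simp: Int_def)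
  have "card (set ` set (filter (\<lambda>b. b \<in> set ys) xs)) = card (set (filter (\<lambda>b. b \<in> set ys) xs))"
    using sorted[OF d(1)] by (intro card_image inj_on_subset[OF inj]) auto
  also have "\<dots> = length (filter (\<lambda>b. b \<in> set ys) xs)"
    using block_listD(1)[OF d(1)] by (intro distinct_card) simp
  finally have "card (set ` set xs \<inter> set ` set ys) = k"
    using Int[OF d(1,2)] f(3) by simp
  moreover have "set ` set xs \<inter> set ` set ys = set ` set xs \<inter> set ` set zs"
    "set ` set xs \<inter> set ` set zs = set ` set ys \<inter> set ` set zs"
    using Int[OF d(1,2)] Int[OF d(1,3)] Int[OF d(2,3)] f by simp_all
  ultimately show ?thesis
    using three_wayI block_list_decomposes d len by metis
qed

section \<open>Transfer to arbitrary point sets and fibres\<close>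

lemma pairs_in_image:
  assumes "bij_betw f S S'"
  shows "pairs_in S' = (`) f ` pairs_in S"
proof
  show "pairs_in S' \<subseteq> (`) f ` pairs_in S"
  proof
    fix P assume "P \<in> pairs_in S'"
    then have P: "P \<subseteq> f ` S" "card P = 2"
      using assms by (auto simp: pairs_in_def bij_betw_def)
    then obtain Q where "Q \<subseteq> S" "P = f ` Q"
      by (meson subset_imageE)
    moreover from this have "card Q = 2"
      using P(2) assms by (metis bij_betw_def card_image inj_on_subset)
    ultimately show "P \<in> (`) f ` pairs_in S"
      by (auto simp: pairs_in_def)
  qed
  show "(`) f ` pairs_in S \<subseteq> pairs_in S'"
  proof
    fix P assume "P \<in> (`) f ` pairs_in S"
    then obtain Q where "Q \<subseteq> S" "card Q = 2" "P = f ` Q"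
      by (auto simp: pairs_in_def)
    then show "P \<in> pairs_in S'"
      using assms by (auto simp: pairs_in_def bij_betw_def card_image inj_on_subset)
  qed
qed

text \<open>The edges of the 4-GDD that inflates \<open>A\<close> by weight 3: the fibre over
  \<open>x\<close> is \<open>{3 * x, 3 * x + 1, 3 * x + 2}\<close>, and injectivity of
  \<open>p div 3\<close> on a pair says that its points lie in different fibres.\<close>

definition fibre_edges :: "nat set \<Rightarrow> nat set set" where
  "fibre_edges A = {P \<in> pairs_in {p. p div 3 \<in> A}. inj_on (\<lambda>p. p div 3) P}"

lemma graph_edges_neq: "graph_edges n (\<noteq>) = pairs_in {..<n}"
  by (auto simp: graph_edges_def pairs_in_def card_2_iff)

lemma graph_edges_div: "graph_edges (3 * n) (\<lambda>x y. x div 3 \<noteq> y div 3) = fibre_edges {..<n}"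
proof -
  have lt: "p < 3 * n \<longleftrightarrow> p div 3 < n" for p :: nat
    by (simp add: div_less_iff_less_mult mult.commute)
  have eq: "P \<in> fibre_edges {..<n} \<longleftrightarrow> (\<exists>x y. P = {x, y} \<and> x div 3 < n \<and> y div 3 < n \<and> x div 3 \<noteq> y div 3)" for P
  proof
    assume "P \<in> fibre_edges {..<n}"
    then have P: "P \<in> pairs_in {p. p div 3 < n}" "inj_on (\<lambda>p. p div 3) P"
      by (auto simp: fibre_edges_def)
    obtain x y where "x div 3 < n" "y div 3 < n" "x \<noteq> y" "P = {x, y}"
      using P(1) by (auto elim: pairs_in_doubleton)
    moreover from this have "x div 3 \<noteq> y div 3"
      using P(2) by (metis insertCI inj_onD)
    ultimately show "\<exists>x y. P = {x, y} \<and> x div 3 < n \<and> y div 3 < n \<and> x div 3 \<noteq> y div 3"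
      by blast
  next
    assume "\<exists>x y. P = {x, y} \<and> x div 3 < n \<and> y div 3 < n \<and> x div 3 \<noteq> y div 3"
    then show "P \<in> fibre_edges {..<n}"
      by (auto simp: fibre_edges_def pairs_in_def card_2_iff)
  qed
  show ?thesis
    unfolding set_eq_iff eq graph_edges_def lt mem_Collect_eq by blast
qed

lemma three_way_pairs_in_transfer:
  assumes "three_way (pairs_in {..<n :: nat}) k" and "finite S" "card S = n"
  shows "three_way (pairs_in S) k"
proof -
  obtain f where f: "bij_betw f {..<n} S"
    using ex_bij_betw_nat_finite[OF assms(2)] assms(3) by (auto simp: lessThan_atLeast0)
  have "inj_on f (\<Union>(pairs_in {..<n}))"
    using bij_betw_imp_inj_on[OF f] by (rule inj_on_subset) (auto simp: pairs_in_def)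
  then show ?thesis
    unfolding pairs_in_image[OF f] by (rule three_way_image[OF assms(1)])
qed

lemma three_way_fibre_edges_transfer:
  assumes "three_way (fibre_edges {..<n}) k" and "finite A" "card A = n"
  shows "three_way (fibre_edges A) k"
proof -
  obtain g where g: "bij_betw g {..<n} A"
    using ex_bij_betw_nat_finite[OF assms(2)] assms(3) by (auto simp: lessThan_atLeast0)
  \<comment> \<open>The lift of \<open>g\<close>: fibres are permuted by \<open>g\<close>, positions
    inside a fibre are kept.\<close>
  define f where "f p = 3 * g (p div 3) + p mod 3" for p
  have f_div: "f p div 3 = g (p div 3)" and f_mod: "f p mod 3 = p mod 3" for p
    by (simp_all add: f_def)
  have f: "bij_betw f {p. p div 3 \<in> {..<n}} {p. p div 3 \<in> A}"
  proof (rule bij_betw_imageI)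
    show "inj_on f {p. p div 3 \<in> {..<n}}"
    proof (rule inj_onI)
      fix p q assume pq: "p \<in> {p. p div 3 \<in> {..<n}}" "q \<in> {p. p div 3 \<in> {..<n}}" "f p = f q"
      then have "g (p div 3) = g (q div 3)" "p mod 3 = q mod 3"
        using f_div f_mod by metis+
      moreover from this have "p div 3 = q div 3"
        using pq(1,2) bij_betw_imp_inj_on[OF g] by (auto dest: inj_onD)
      ultimately show "p = q"
        by (metis div_mult_mod_eq)
    qed
    show "f ` {p. p div 3 \<in> {..<n}} = {p. p div 3 \<in> A}"
    proof
      show "f ` {p. p div 3 \<in> {..<n}} \<subseteq> {p. p div 3 \<in> A}"
        using bij_betw_apply[OF g] by (auto simp: f_div)
      show "{p. p div 3 \<in> A} \<subseteq> f ` {p. p div 3 \<in> {..<n}}"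
      proof
        fix q assume "q \<in> {p. p div 3 \<in> A}"
        then obtain i where i: "i < n" "q div 3 = g i"
          using bij_betw_imp_surj_on[OF g] by auto
        have "f (3 * i + q mod 3) = q"
          unfolding f_def using i(2)[symmetric] by simp
        then show "q \<in> f ` {p. p div 3 \<in> {..<n}}"
          using i(1) by (intro image_eqI[of _ _ "3 * i + q mod 3"]) auto
      qed
    qed
  qed
  \<comment> \<open>Projecting after \<open>f\<close> is \<open>g\<close> after projecting, and
    \<open>g\<close> is injective, so lying in different fibres is preserved both ways.\<close>
  have inj_iff: "inj_on (\<lambda>p. p div 3) (f ` Q) \<longleftrightarrow> inj_on (\<lambda>p. p div 3) Q"
    if Q: "Q \<subseteq> {p. p div 3 \<in> {..<n}}" for Q
  proof -
    have "inj_on f Q"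
      using bij_betw_imp_inj_on[OF f] Q by (rule inj_on_subset)
    then have "inj_on (\<lambda>p. p div 3) (f ` Q) \<longleftrightarrow> inj_on (g \<circ> (\<lambda>p. p div 3)) Q"
      by (simp add: comp_inj_on_iff o_def f_div)
    moreover have "inj_on g ((\<lambda>p. p div 3) ` Q)"
      using bij_betw_imp_inj_on[OF g] by (rule inj_on_subset) (use Q in auto)
    ultimately show ?thesis
      using inj_on_imageI2 comp_inj_on by blast
  qed
  have "fibre_edges A = (`) f ` fibre_edges {..<n}"
    unfolding fibre_edges_def pairs_in_image[OF f] using inj_iff by (auto simp: pairs_in_def)
  moreover have "inj_on f (\<Union>(fibre_edges {..<n}))"
    using bij_betw_imp_inj_on[OF f]
    by (rule inj_on_subset) (auto simp: fibre_edges_def pairs_in_def)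
  ultimately show ?thesis
    using three_way_image[OF assms(1)] by simp
qed

subsection \<open>The two ingredients\<close>

text \<open>The projective plane of order 3, developed from the difference set {0, 1, 3, 9} modulo
  13.\<close>

definition plane13 :: "nat list list" where
  "plane13 =
    [[0,1,3,9], [0,2,8,12], [0,4,5,7], [0,6,10,11], [1,2,4,10], [1,5,6,8], [1,7,11,12],
    [2,3,5,11], [2,6,7,9], [3,4,6,12], [3,7,8,10], [4,8,9,11], [5,9,10,12]]"

text \<open>The affine plane of order 4 without one point; the groups \<open>{3 * i, 3 * i + 1, 3 * i + 2}\<close> are the
  punctured lines through that point.\<close>

definition gdd15 :: "nat list list" where
  "gdd15 =
    [[0,3,10,14], [0,4,8,9], [0,5,7,12], [0,6,11,13], [1,3,8,13], [1,4,11,12], [1,5,6,10],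
    [1,7,9,14], [2,3,7,11], [2,4,6,14], [2,5,9,13], [2,8,10,12], [3,6,9,12], [4,7,10,13],
    [5,8,11,14]]"

text \<open>The certificates for 0 to 5 each set two further planes on the same points against
  \<open>plane13\<close>; 13 takes one plane three times.\<close>

lemma three_way_plane_0: "three_way (graph_edges 13 (\<noteq>)) 0"
  by (rule three_way_lists[where xs = plane13 and
    ys = "[[0,1,3,4], [0,2,5,12], [0,6,8,9], [0,7,10,11], [1,2,6,7], [1,5,9,10], [1,8,11,12],
    [2,3,9,11], [2,4,8,10], [3,5,7,8], [3,6,10,12], [4,5,6,11], [4,7,9,12]]" and
    zs = "[[0,1,5,6], [0,2,3,7], [0,4,8,9], [0,10,11,12], [1,2,9,10], [1,3,8,11], [1,4,7,12],
    [2,4,5,11], [2,6,8,12], [3,4,6,10], [3,5,9,12], [5,7,8,10], [6,7,9,11]]"])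
    code_simp

lemma three_way_plane_1: "three_way (graph_edges 13 (\<noteq>)) 1"
  by (rule three_way_lists[where xs = plane13 and
    ys = "[[0,1,11,12], [0,2,6,7], [0,3,4,8], [0,5,9,10], [1,2,4,9], [1,3,6,10], [1,5,7,8],
    [2,3,5,11], [2,8,10,12], [3,7,9,12], [4,5,6,12], [4,7,10,11], [6,8,9,11]]" and
    zs = "[[0,1,3,4], [0,2,8,9], [0,5,7,10], [0,6,11,12], [1,2,7,12], [1,5,6,9], [1,8,10,11],
    [2,3,5,11], [2,4,6,10], [3,6,7,8], [3,9,10,12], [4,5,8,12], [4,7,9,11]]"])
    code_simp

lemma three_way_plane_2: "three_way (graph_edges 13 (\<noteq>)) 2"
  by (rule three_way_lists[where xs = plane13 and
    ys = "[[0,1,3,9], [0,2,4,12], [0,5,6,10], [0,7,8,11], [1,2,10,11], [1,4,6,8], [1,5,7,12],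
    [2,3,5,8], [2,6,7,9], [3,4,7,10], [3,6,11,12], [4,5,9,11], [8,9,10,12]]" and
    zs = "[[0,1,3,9], [0,2,5,11], [0,4,7,12], [0,6,8,10], [1,2,8,12], [1,4,6,11], [1,5,7,10],
    [2,3,4,10], [2,6,7,9], [3,5,6,12], [3,7,8,11], [4,5,8,9], [9,10,11,12]]"])
    code_simp

lemma three_way_plane_3: "three_way (graph_edges 13 (\<noteq>)) 3"
  by (rule three_way_lists[where xs = plane13 and
    ys = "[[0,1,6,9], [0,2,7,12], [0,3,10,11], [0,4,5,8], [1,2,4,10], [1,3,5,7], [1,8,11,12],
    [2,3,8,9], [2,5,6,11], [3,4,6,12], [4,7,9,11], [5,9,10,12], [6,7,8,10]]" and
    zs = "[[0,1,11,12], [0,2,5,6], [0,3,7,10], [0,4,8,9], [1,2,4,10], [1,3,5,8], [1,6,7,9],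
    [2,3,9,11], [2,7,8,12], [3,4,6,12], [4,5,7,11], [5,9,10,12], [6,8,10,11]]"])
    code_simp

lemma three_way_plane_4: "three_way (graph_edges 13 (\<noteq>)) 4"
  by (rule three_way_lists[where xs = plane13 and
    ys = "[[0,1,4,10], [0,2,8,12], [0,3,9,11], [0,5,6,7], [1,2,6,9], [1,3,5,8], [1,7,11,12],
    [2,3,7,10], [2,4,5,11], [3,4,6,12], [4,7,8,9], [5,9,10,12], [6,8,10,11]]" and
    zs = "[[0,1,6,10], [0,2,8,12], [0,3,7,9], [0,4,5,11], [1,2,3,5], [1,4,8,9], [1,7,11,12],
    [2,4,7,10], [2,6,9,11], [3,4,6,12], [3,8,10,11], [5,6,7,8], [5,9,10,12]]"])
    code_simp

lemma three_way_plane_5: "three_way (graph_edges 13 (\<noteq>)) 5"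
  by (rule three_way_lists[where xs = plane13 and
    ys = "[[0,1,3,9], [0,2,8,12], [0,4,5,7], [0,6,10,11], [1,2,4,11], [1,5,6,12], [1,7,8,10],
    [2,3,5,10], [2,6,7,9], [3,4,6,8], [3,7,11,12], [4,9,10,12], [5,8,9,11]]" and
    zs = "[[0,1,3,9], [0,2,8,12], [0,4,5,7], [0,6,10,11], [1,2,5,10], [1,4,6,12], [1,7,8,11],
    [2,3,4,11], [2,6,7,9], [3,5,6,8], [3,7,10,12], [4,8,9,10], [5,9,11,12]]"])
    code_simp

lemma three_way_plane_13: "three_way (graph_edges 13 (\<noteq>)) 13"
  by (rule three_way_lists[where xs = plane13 and ys = plane13 and zs = plane13]) code_simp

text \<open>Sizes 0 and 15 switch a whole line on or off in the final sums; size 1 serves to reach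
  424.\<close>

lemma three_way_gdd_0: "three_way (graph_edges 15 (\<lambda>x y. x div 3 \<noteq> y div 3)) 0"
  by (rule three_way_lists[where xs = gdd15 and
    ys = "[[0,3,11,12], [0,4,7,9], [0,5,8,13], [0,6,10,14], [1,3,7,14], [1,4,10,13], [1,5,6,11],
    [1,8,9,12], [2,3,8,10], [2,4,6,12], [2,5,9,14], [2,7,11,13], [3,6,9,13], [4,8,11,14],
    [5,7,10,12]]" and
    zs = "[[0,3,7,10], [0,4,11,13], [0,5,8,12], [0,6,9,14], [1,3,6,13], [1,4,8,9], [1,5,10,14],
    [1,7,11,12], [2,3,9,12], [2,4,7,14], [2,5,6,11], [2,8,10,13], [3,8,11,14], [4,6,10,12],
    [5,7,9,13]]"])
    code_simp

lemma three_way_gdd_1: "three_way (graph_edges 15 (\<lambda>x y. x div 3 \<noteq> y div 3)) 1"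
  by (rule three_way_lists[where xs = gdd15 and
    ys = "[[0,3,11,14], [0,4,8,9], [0,5,6,13], [0,7,10,12], [1,3,6,10], [1,4,7,14], [1,5,9,12],
    [1,8,11,13], [2,3,8,12], [2,4,10,13], [2,5,7,11], [2,6,9,14], [3,7,9,13], [4,6,11,12],
    [5,8,10,14]]" and
    zs = "[[0,3,11,12], [0,4,8,9], [0,5,7,14], [0,6,10,13], [1,3,7,10], [1,4,6,12], [1,5,9,13],
    [1,8,11,14], [2,3,8,13], [2,4,10,14], [2,5,6,11], [2,7,9,12], [3,6,9,14], [4,7,11,13],
    [5,8,10,12]]"])
    code_simp

lemma three_way_gdd_15: "three_way (graph_edges 15 (\<lambda>x y. x div 3 \<noteq> y div 3)) 15"
  by (rule three_way_lists[where xs = gdd15 and ys = gdd15 and zs = gdd15]) code_simp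

text \<open>The affine plane of order 5 without the origin: \<open>groups\<close> are the punctured lines through the
  origin, \<open>lines\<close> the remaining ones.\<close>

definition lines :: "nat list list" where
  "lines =
    [[0,4,10,13,19], [0,5,11,16,22], [0,6,9,15,20], [0,7,12,18,21], [0,8,14,17,23],
    [1,4,11,14,21], [1,5,8,15,18], [1,6,13,16,23], [1,7,10,17,20], [1,9,12,19,22],
    [2,4,9,18,23], [2,5,14,19,20], [2,6,11,12,17], [2,7,8,13,22], [2,10,15,16,21],
    [3,4,15,17,22], [3,5,10,12,23], [3,6,8,19,21], [3,7,9,14,16], [3,11,13,18,20],
    [4,8,12,16,20], [5,9,13,17,21], [6,10,14,18,22], [7,11,15,19,23]]"

definition groups :: "nat list list" where
  "groups = map (\<lambda>i. [4 * i..<4 * i + 4]) [0..<6]"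

text \<open>Together the lines and groups form a pairwise balanced design on 24 points with block
  sizes 5 and 4.\<close>

lemma block_list_lines_groups: "block_list 24 (\<noteq>) (lines @ groups)"
  by code_simp

subsection \<open>Inflating the affine plane of order 5\<close>

lemma three_way_plane:
  assumes "k \<in> {0, 1, 2, 3, 4, 5, 13}" "finite S" "card S = 13"
  shows "three_way (pairs_in S) k"
  using assms(1) three_way_plane_0 three_way_plane_1 three_way_plane_2 three_way_plane_3
    three_way_plane_4 three_way_plane_5 three_way_plane_13
  by (intro three_way_pairs_in_transfer[OF _ assms(2,3)]) (auto simp: graph_edges_neq)

lemma three_way_gdd:
  assumes "k \<in> {0, 1, 15}" "finite A" "card A = 5"
  shows "three_way (fibre_edges A) k"
  using assms(1) three_way_gdd_0 three_way_gdd_1 three_way_gdd_15 graph_edges_div[of 5]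
  by (intro three_way_fibre_edges_transfer[OF _ assms(2,3)]) auto

text \<open>The point p of the 73-set lies in the fibre over p div 3, and 72 is the point at infinity.\<close>

definition cone :: "nat list \<Rightarrow> nat set" where
  "cone G = insert 72 {p. p div 3 \<in> set G}"

lemma lines_length: "L \<in> set lines \<Longrightarrow> length L = 5"
  by (auto simp: lines_def)

lemma groups_length: "G \<in> set groups \<Longrightarrow> length G = 4"
  by (auto simp: groups_def)

lemma lines_groups_lt: "L \<in> set lines \<union> set groups \<Longrightarrow> x \<in> set L \<Longrightarrow> x < 24"
  using block_listD(3)[OF block_list_lines_groups, of L] by auto

lemma lines_groups_unique:
  assumes "L \<in> set lines \<union> set groups" "L' \<in> set lines \<union> set groups"
    and "{x, y} \<subseteq> set L" "{x, y} \<subseteq> set L'" "x \<noteq> y"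
  shows "L = L'"
  using block_listD(6)[OF block_list_lines_groups, of L L' x y] assms by simp

lemma groups_eq:
  assumes "G \<in> set groups" "x \<in> set G"
  shows "G = [4 * (x div 4)..<4 * (x div 4) + 4]"
proof -
  obtain i where i: "G = [4 * i..<4 * i + 4]"
    using assms(1) by (auto simp: groups_def)
  with assms(2) have "x div 4 = i"
    by (simp add: div_nat_eqI)
  with i show ?thesis
    by simp
qed

lemma groups_unique: "G \<in> set groups \<Longrightarrow> G' \<in> set groups \<Longrightarrow> x \<in> set G \<Longrightarrow> x \<in> set G' \<Longrightarrow> G = G'"
  using groups_eq by metis

lemma groups_cover:
  assumes "x < 24"
  shows "\<exists>G\<in>set groups. x \<in> set G"
proof -
  have "x \<in> set [4 * (x div 4)..<4 * (x div 4) + 4]"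
    by simp
  moreover have "[4 * (x div 4)..<4 * (x div 4) + 4] \<in> set groups"
    using assms unfolding groups_def set_map by (intro imageI) (simp add: div_less_iff_less_mult)
  ultimately show ?thesis
    by blast
qed

lemma card_cone:
  assumes "G \<in> set groups"
  shows "finite (cone G)" "card (cone G) = 13"
proof -
  have "p \<in> {3 * x..<3 * x + 3} \<longleftrightarrow> p div 3 = x" for p x :: nat
    unfolding atLeastLessThan_iff by presburger
  then have eq: "{p. p div 3 \<in> set G} = (\<Union>x\<in>set G. {3 * x..<3 * x + 3})"
    by (simp add: set_eq_iff del: atLeastLessThan_iff)
  have "card {p. p div 3 \<in> set G} = (\<Sum>x\<in>set G. card {3 * x..<3 * x + 3})"
    unfolding eq by (rule card_UN_disjoint) auto
  also have "\<dots> = 12"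
    using assms by (auto simp: groups_def)
  finally have "card {p. p div 3 \<in> set G} = 12" .
  moreover have fin: "finite {p. p div 3 \<in> set G}"
    unfolding eq by simp
  \<comment> \<open>The point at infinity would lie over 24, while the plane has the points 0 to
    23.\<close>
  moreover have "72 \<notin> {p :: nat. p div 3 \<in> set G}"
    using lines_groups_lt[of G 24] assms by auto
  ultimately show "finite (cone G)" "card (cone G) = 13"
    by (simp_all add: cone_def)
qed

lemma card_lines:
  assumes "L \<in> set lines"
  shows "card (set L) = 5"
  using block_listD(2)[OF block_list_lines_groups, of L] lines_length[OF assms] assms
  by (simp add: distinct_card strict_sorted_iff)

text \<open>Two points over different base points belong to the line or group joining these; two
  points of one fibre, or a point and infinity, belong to the cone of the group containing the base
  point.\<close>

lemma pairs_73:
  "pairs_in {..<73} = (\<Union>L\<in>set lines. fibre_edges (set L)) \<union> (\<Union>G\<in>set groups. pairs_in (cone G))"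
proof
  have lt: "p < 72" if "L \<in> set lines \<union> set groups" "p div 3 \<in> set L" for p L
    using lines_groups_lt[OF that] by simp
  then have "cone G \<subseteq> {..<73}" if "G \<in> set groups" for G
    using that unfolding cone_def by fastforce
  moreover have "{p. p div 3 \<in> set L} \<subseteq> {..<73}" if "L \<in> set lines" for L
    using that lt by fastforce
  ultimately show "(\<Union>L\<in>set lines. fibre_edges (set L)) \<union> (\<Union>G\<in>set groups. pairs_in (cone G)) \<subseteq> pairs_in {..<73}"
    unfolding fibre_edges_def pairs_in_def by blast
  show "pairs_in {..<73} \<subseteq> (\<Union>L\<in>set lines. fibre_edges (set L)) \<union> (\<Union>G\<in>set groups. pairs_in (cone G))"
  proof
    fix P :: "nat set" assume P: "P \<in> pairs_in {..<73}"
    then have "card P = 2"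
      by (simp add: pairs_in_def)
    obtain p q where pq: "p < 73" "q < 73" "p \<noteq> q" "P = {p, q}"
      using P by (auto elim: pairs_in_doubleton)
    have group: "P \<in> (\<Union>G\<in>set groups. pairs_in (cone G))" if "G \<in> set groups" "p \<in> cone G" "q \<in> cone G" for G
      using that pq(4) \<open>card P = 2\<close> by (auto simp: pairs_in_def)
    consider "p = 72" "q div 3 < 24" | "q = 72" "p div 3 < 24" | "p div 3 = q div 3" "q div 3 < 24"
      | "p div 3 < 24" "q div 3 < 24" "p div 3 \<noteq> q div 3"
      using pq(1-3) by linarith
    then show "P \<in> (\<Union>L\<in>set lines. fibre_edges (set L)) \<union> (\<Union>G\<in>set groups. pairs_in (cone G))"
    proof cases
      case 4
      then obtain b where b: "b \<in> set lines \<union> set groups" "p div 3 \<in> set b" "q div 3 \<in> set b"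
        using block_listD(5)[OF block_list_lines_groups, of "p div 3" "q div 3"] by auto
      show ?thesis
      proof (cases "b \<in> set lines")
        case True
        then have "P \<in> fibre_edges (set b)"
          using b(2,3) 4(3) pq(4) \<open>card P = 2\<close> by (auto simp: fibre_edges_def pairs_in_def)
        then show ?thesis
          using True by blast
      next
        case False
        then show ?thesis
          using b by (intro UnI2 group[of b]) (auto simp: cone_def)
      qed
    qed (use groups_cover group in \<open>auto simp: cone_def\<close>)
  qed
qed

lemma three_way_groups:
  assumes "length ks = 6" "set ks \<subseteq> {0, 1, 2, 3, 4, 5, 13}"
  shows "three_way (\<Union>G\<in>set groups. pairs_in (cone G)) (sum_list ks)"
proof (rule three_way_UN)
  have "distinct groups" "length groups = 6"
    using block_listD(1)[OF block_list_lines_groups] by (simp, simp add: groups_def)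
  then show "length ks = card (set groups)"
    using assms(1) by (simp add: distinct_card)
  show "three_way (pairs_in (cone G)) k" if "G \<in> set groups" "k \<in> set ks" for G k
    using three_way_plane card_cone[OF that(1)] that(2) assms(2) by blast
  \<comment> \<open>Of two common points one is finite, and its base point would lie in both
    groups.\<close>
  show "pairs_in (cone G) \<inter> pairs_in (cone G') = {}" if G: "G \<in> set groups" "G' \<in> set groups" "G \<noteq> G'" for G G'
  proof (rule ccontr)
    assume "\<not> ?thesis"
    then obtain P where P: "P \<in> pairs_in (cone G)" "P \<subseteq> cone G'"
      by (auto simp: pairs_in_def)
    obtain p q where pq: "p \<in> cone G" "q \<in> cone G" "p \<noteq> q" "P = {p, q}"
      using P(1) by (rule pairs_in_doubleton)
    then obtain x where "x \<in> cone G" "x \<in> cone G'" "x \<noteq> 72"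
      using P(2) by auto
    then have "x div 3 \<in> set G" "x div 3 \<in> set G'"
      by (auto simp: cone_def)
    then show False
      using groups_unique G by blast
  qed
qed simp

lemma three_way_lines:
  assumes "length ks = 24" "set ks \<subseteq> {0, 1, 15}"
  shows "three_way (\<Union>L\<in>set lines. fibre_edges (set L)) (sum_list ks)"
proof (rule three_way_UN)
  have "distinct lines" "length lines = 24"
    using block_listD(1)[OF block_list_lines_groups] by (simp, simp add: lines_def)
  then show "length ks = card (set lines)"
    using assms(1) by (simp add: distinct_card)
  show "three_way (fibre_edges (set L)) k" if "L \<in> set lines" "k \<in> set ks" for L k
    using three_way_gdd card_lines[OF that(1)] that(2) assms(2) by blast
  show "fibre_edges (set L) \<inter> fibre_edges (set L') = {}" if L: "L \<in> set lines" "L' \<in> set lines" "L \<noteq> L'" for L L'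
  proof (rule ccontr)
    assume "\<not> ?thesis"
    then obtain P where P: "P \<in> pairs_in {p. p div 3 \<in> set L}" "inj_on (\<lambda>p. p div 3) P" "P \<subseteq> {p. p div 3 \<in> set L'}"
      by (auto simp: fibre_edges_def pairs_in_def)
    obtain p q where pq: "p div 3 \<in> set L" "q div 3 \<in> set L" "p \<noteq> q" "P = {p, q}"
      using P(1) by (auto elim: pairs_in_doubleton)
    have "p div 3 \<noteq> q div 3"
      using P(2) pq(3,4) by (auto simp: inj_on_def)
    then show False
      using lines_groups_unique[of L L' "p div 3" "q div 3"] L P(3) pq by auto
  qed
qed simp

lemma three_way_73:
  assumes "length ks = 24" "set ks \<subseteq> {0, 1, 15}" "length ls = 6" "set ls \<subseteq> {0, 1, 2, 3, 4, 5, 13}"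
  shows "three_way (pairs_in {..<73 :: nat}) (sum_list ks + sum_list ls)"
  unfolding pairs_73
proof (rule three_way_Un)
  \<comment> \<open>A common pair projects to two base points on both \<open>L\<close> and
    \<open>G\<close>, forcing \<open>L = G\<close>, but the lengths are 5 and 4.\<close>
  have "fibre_edges (set L) \<inter> pairs_in (cone G) = {}" if LG: "L \<in> set lines" "G \<in> set groups" for L G
  proof (rule ccontr)
    assume "\<not> ?thesis"
    then obtain P where P: "P \<in> pairs_in {p. p div 3 \<in> set L}" "inj_on (\<lambda>p. p div 3) P" "P \<subseteq> cone G"
      by (auto simp: fibre_edges_def pairs_in_def)
    obtain p q where pq: "p div 3 \<in> set L" "q div 3 \<in> set L" "p \<noteq> q" "P = {p, q}"
      using P(1) by (auto elim: pairs_in_doubleton)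
    have "p div 3 \<noteq> q div 3"
      using P(2) pq(3,4) by (auto simp: inj_on_def)
    moreover have "p \<noteq> 72" "q \<noteq> 72"
      using lines_groups_lt[of L "p div 3"] lines_groups_lt[of L "q div 3"] LG(1) pq(1,2) by auto
    then have "p div 3 \<in> set G" "q div 3 \<in> set G"
      using P(3) pq(4) by (auto simp: cone_def)
    ultimately have "L = G"
      using lines_groups_unique[of L G "p div 3" "q div 3"] LG pq(1,2) by simp
    then show False
      using lines_length groups_length LG by fastforce
  qed
  then show "(\<Union>L\<in>set lines. fibre_edges (set L)) \<inter> (\<Union>G\<in>set groups. pairs_in (cone G)) = {}"
    by blast
qed (use three_way_lines three_way_groups assms in auto)

subsection \<open>The attainable intersection sizes\<close>

text \<open>Greedy choice: the next entry is as large as \<open>m\<close> and the remaining sum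
  permit.\<close>

lemma ex_list_sum:
  fixes r m n :: nat
  assumes "r \<le> m * n"
  shows "\<exists>ks. length ks = n \<and> set ks \<subseteq> {..m} \<and> sum_list ks = r"
  using assms
proof (induction n arbitrary: r)
  case (Suc n)
  then have "r - min r m \<le> m * n"
    by (auto simp: min_def)
  from Suc.IH[OF this] obtain ks where ks: "length ks = n" "set ks \<subseteq> {..m}" "sum_list ks = r - min r m"
    by blast
  then show ?case
    by (intro exI[of _ "min r m # ks"]) auto
qed simp

text \<open>With \<open>j\<close> entries 13 and \<open>6 - j\<close> entries up to 5 the sums fill
  the interval from \<open>13 * j\<close> to \<open>30 + 8 * j\<close>. These intervals overlap for
  \<open>j\<close> from 0 to 4 and leave gaps after 62 and after 70.\<close>

lemma plane_sums:
  fixes s :: nat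
  assumes "s \<le> 62 \<or> 65 \<le> s \<and> s \<le> 70 \<or> s = 78"
  shows "\<exists>ls. length ls = 6 \<and> set ls \<subseteq> {0, 1, 2, 3, 4, 5, 13} \<and> sum_list ls = s"
proof -
  have "\<exists>j\<le>6. 13 * j \<le> s \<and> s - 13 * j \<le> 5 * (6 - j)"
  proof -
    consider "s \<le> 30" | "30 < s" "s \<le> 38" | "38 < s" "s \<le> 46" | "46 < s" "s \<le> 54" | "54 < s" "s \<le> 62"
      | "65 \<le> s" "s \<le> 70" | "s = 78"
      using assms by linarith
    then show ?thesis
    proof cases
      case 1 then show ?thesis by (intro exI[of _ 0]) simp
    next
      case 2 then show ?thesis by (intro exI[of _ 1]) simp
    next
      case 3 then show ?thesis by (intro exI[of _ 2]) simp
    next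
      case 4 then show ?thesis by (intro exI[of _ 3]) simp
    next
      case 5 then show ?thesis by (intro exI[of _ 4]) simp
    next
      case 6 then show ?thesis by (intro exI[of _ 5]) simp
    next
      case 7 then show ?thesis by (intro exI[of _ 6]) simp
    qed
  qed
  then obtain j where j: "j \<le> 6" "13 * j \<le> s" "s - 13 * j \<le> 5 * (6 - j)"
    by blast
  then obtain ks where ks: "length ks = 6 - j" "set ks \<subseteq> {..5}" "sum_list ks = s - 13 * j"
    using ex_list_sum by blast
  have "x \<in> {0, 1, 2, 3, 4, 5, 13}" if "x \<in> set ks" for x
  proof -
    have "x \<le> 5"
      using ks(2) that by auto
    then have "x = 0 \<or> x = 1 \<or> x = 2 \<or> x = 3 \<or> x = 4 \<or> x = 5"
      by linarith
    then show ?thesis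
      by auto
  qed
  then show ?thesis
    using j ks by (intro exI[of _ "replicate j 13 @ ks"]) (auto simp: sum_list_replicate)
qed

lemma three_way_73_all:
  assumes "k \<le> 430 \<or> k = 438"
  shows "three_way (pairs_in {..<73 :: nat}) k"
proof -
  \<comment> \<open>Here \<open>c\<close> lines contribute 15, \<open>e\<close> lines contribute 1,
    and the six cones contribute \<open>s\<close>.\<close>
  have *: "three_way (pairs_in {..<73 :: nat}) (15 * c + e + s)"
    if ce: "c + e \<le> 24" "e \<le> 1" and s: "s \<le> 62 \<or> 65 \<le> s \<and> s \<le> 70 \<or> s = 78" for c e s
  proof -
    obtain ls where ls: "length ls = 6" "set ls \<subseteq> {0, 1, 2, 3, 4, 5, 13}" "sum_list ls = s"
      using plane_sums[OF s] by blast
    let ?ks = "replicate c 15 @ replicate e 1 @ replicate (24 - c - e) (0 :: nat)"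
    have "three_way (pairs_in {..<73 :: nat}) (sum_list ?ks + sum_list ls)"
      using ce by (intro three_way_73 ls) auto
    then show ?thesis
      using ls(3) by (simp add: sum_list_replicate mult.commute add.assoc)
  qed
  \<comment> \<open>All 24 lines give 360. The gap 63, 64 of the cone sums leaves out 423 and 424,
    which arise as 345 + 78 and 345 + 1 + 78.\<close>
  consider "k < 375" | "375 \<le> k" "k \<le> 422" | "k = 423" | "k = 424" | "425 \<le> k" "k \<le> 430" | "k = 438"
    using assms by linarith
  then show ?thesis
  proof cases
    case 1
    then have "k div 15 < 25"
      by (simp add: div_less_iff_less_mult)
    moreover have "k mod 15 < 15"
      by simp
    ultimately have "k div 15 \<le> 24" "k mod 15 \<le> 62"
      by linarith+
    then show ?thesis
      using *[of "k div 15" 0 "k mod 15"] by simp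
  next
    case 2
    then have "k - 360 \<le> 62"
      by linarith
    with 2 show ?thesis
      using *[of 24 0 "k - 360"] by simp
  next
    case 3 then show ?thesis using *[of 23 0 78] by simp
  next
    case 4 then show ?thesis using *[of 23 1 78] by simp
  next
    case 5
    then have "65 \<le> k - 360 \<and> k - 360 \<le> 70"
      by linarith
    with 5 show ?thesis
      using *[of 24 0 "k - 360"] by simp
  next
    case 6 then show ?thesis using *[of 24 0 78] by simp
  qed
qed

section \<open>Necessity: from designs to trades\<close>

lemma decomposes_card:
  assumes B: "decomposes B E"
  shows "card E = 6 * card B"
proof -
  note D = decomposesD[OF B]
  have "E = (\<Union>b\<in>B. pairs_in b)"
  proof
    show "E \<subseteq> (\<Union>b\<in>B. pairs_in b)"
      using D(2,5) by (fastforce simp: pairs_in_def)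
    show "(\<Union>b\<in>B. pairs_in b) \<subseteq> E"
      using B by (auto simp: decomposes_def)
  qed
  also have "card \<dots> = (\<Sum>b\<in>B. card (pairs_in b))"
  proof (rule card_UN_disjoint)
    show "\<forall>b\<in>B. finite (pairs_in b)"
    proof
      fix b assume "b \<in> B"
      then have "finite b"
        using D(3) by (simp add: card_ge_0_finite)
      then show "finite (pairs_in b)"
        by (simp add: pairs_in_def)
    qed
    show "\<forall>b\<in>B. \<forall>b'\<in>B. b \<noteq> b' \<longrightarrow> pairs_in b \<inter> pairs_in b' = {}"
    proof (intro ballI impI, rule ccontr)
      fix b b' assume b: "b \<in> B" "b' \<in> B" "b \<noteq> b'" "pairs_in b \<inter> pairs_in b' \<noteq> {}"
      then obtain P where "P \<subseteq> b" "P \<subseteq> b'" "card P = 2"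
        by (auto simp: pairs_in_def)
      then show False
        using D(6)[OF D(4)] b(1-3) by metis
    qed
  qed (rule D(1))
  also have "\<dots> = (\<Sum>b\<in>B. 6)"
  proof (rule sum.cong)
    fix b assume "b \<in> B"
    then have "card b = 4" "finite b"
      using D(3) by (auto intro: card_ge_0_finite)
    then show "card (pairs_in b) = 6"
      unfolding pairs_in_def by (simp add: n_subsets choose_two)
  qed simp
  finally show ?thesis
    by simp
qed

lemma decomposes_linear_quads:
  assumes B: "decomposes B E"
  shows "linear_quads (B - C)"
  unfolding linear_quads_def
proof (intro conjI ballI allI impI)
  fix b b' x y
  assume b: "b \<in> B - C" "b' \<in> B - C" and xy: "x \<noteq> y" "{x, y} \<subseteq> b" "{x, y} \<subseteq> b'"
  have "{x, y} \<in> E"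
    using decomposesD(4)[OF B, of b "{x, y}"] b xy by simp
  then show "b = b'"
    using decomposesD(6)[OF B] b xy by blast
qed (use decomposesD(1,3)[OF B] in auto)

text \<open>A pair in a remaining block of \<open>B\<close> is not covered by a common block, since
  that block would be a second one of \<open>B\<close> on the pair; so the block of \<open>C\<close>
  covering it remains too.\<close>

lemma decomposes_steiner_trade:
  assumes B: "decomposes B E" and C: "decomposes C E"
  shows "steiner_trade (B - B \<inter> C) (C - B \<inter> C)"
proof
  show "linear_quads (B - B \<inter> C)" "linear_quads (C - B \<inter> C)"
    using decomposes_linear_quads B C by blast+
  have cover: "\<exists>c\<in>C - B \<inter> C. {x, y} \<subseteq> c"
    if B: "decomposes B E" and C: "decomposes C E" and xy: "x \<noteq> y" and b: "b \<in> B - B \<inter> C" "{x, y} \<subseteq> b"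
    for B C b and x y
  proof -
    have E: "{x, y} \<in> E"
      using decomposesD(4)[OF B, of b "{x, y}"] b xy by simp
    then obtain c where c: "c \<in> C" "{x, y} \<subseteq> c"
      using decomposesD(5)[OF C] by blast
    have "c \<notin> B"
    proof
      assume "c \<in> B"
      then have "b = c"
        using decomposesD(6)[OF B E] b c(2) by blast
      then show False
        using b c(1) by blast
    qed
    then show ?thesis
      using c by blast
  qed
  show "(\<exists>b\<in>B - B \<inter> C. {x, y} \<subseteq> b) \<longleftrightarrow> (\<exists>b\<in>C - B \<inter> C. {x, y} \<subseteq> b)" if "x \<noteq> y" for x y
    using cover[OF B C that] cover[OF C B that] by (metis Int_commute)
qed auto

text \<open>Here \<open>n\<close> is the number of blocks. Deleting the \<open>k\<close> common ones
  leaves trades of \<open>n - k\<close> blocks, and sizes 1 to 7 are impossible.\<close>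

lemma three_way_bound:
  assumes "three_way E k" and E: "card E = 6 * n"
  shows "k = n \<or> k + 8 \<le> n"
proof -
  obtain B1 B2 B3 where B: "decomposes B1 E" "decomposes B2 E" "decomposes B3 E"
    "B1 \<inter> B2 = B1 \<inter> B3" "B1 \<inter> B3 = B2 \<inter> B3" "card (B1 \<inter> B2) = k"
    using assms(1) unfolding three_way_def by blast
  have fin: "finite B1" and card: "card B1 = n"
    using decomposesD(1)[OF B(1)] decomposes_card[OF B(1)] E by auto
  have k: "k \<le> n" "card (B1 - B1 \<inter> B2) = n - k"
    using card_mono[OF fin, of "B1 \<inter> B2"] card_Diff_subset[of "B1 \<inter> B2" B1] fin card B(6) by auto
  have "k + 8 \<le> n" if "k \<noteq> n"
  proof (rule ccontr)
    assume "\<not> k + 8 \<le> n"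
    then have "card (B1 - B1 \<inter> B2) \<le> 7" "card (B1 - B1 \<inter> B2) \<noteq> 0"
      using k that by linarith+
    moreover from this have "B1 - B1 \<inter> B2 \<noteq> {}"
      by (metis card.empty)
    \<comment> \<open>Equal pairwise intersections make \<open>B1 \<inter> B2\<close> also the
      common part of \<open>B1\<close> and \<open>B3\<close>, so both trades start from the same
      half.\<close>
    moreover have "steiner_trade (B1 - B1 \<inter> B2) (B3 - B1 \<inter> B2)"
      using decomposes_steiner_trade[OF B(1,3)] B(4) by simp
    moreover have "(B2 - B1 \<inter> B2) \<inter> (B3 - B1 \<inter> B2) = {}"
      using B(4,5) by blast
    ultimately show False
      using no_small_trade decomposes_steiner_trade[OF B(1,2)] by metis
  qed
  then show ?thesis
    by blast
qed

lemma J3_iff_three_way: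
  "k \<in> J3 v \<longleftrightarrow> (\<exists>V n. finite (V :: nat set) \<and> card V = v \<and> three_way (pairs_in V) n \<and> k = int n)"
proof
  assume "k \<in> J3 v"
  then obtain V :: "nat set" and B1 B2 B3 where B: "S24_design v V B1" "S24_design v V B2" "S24_design v V B3"
    "B1 \<inter> B2 = B1 \<inter> B3" "B1 \<inter> B3 = B2 \<inter> B3" "int (card (B1 \<inter> B2)) = k"
    unfolding J3_def by blast
  then have "three_way (pairs_in V) (card (B1 \<inter> B2))"
    by (intro three_wayI[of B1 _ B2 B3]) (simp_all add: S24_design_iff_decomposes)
  with B show "\<exists>V n. finite (V :: nat set) \<and> card V = v \<and> three_way (pairs_in V) n \<and> k = int n"
    by (auto simp: S24_design_iff_decomposes)
next
  assume "\<exists>V n. finite (V :: nat set) \<and> card V = v \<and> three_way (pairs_in V) n \<and> k = int n"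
  then obtain V :: "nat set" and n where V: "finite V" "card V = v" "three_way (pairs_in V) n" "k = int n"
    by blast
  then obtain B1 B2 B3 where "decomposes B1 (pairs_in V)" "decomposes B2 (pairs_in V)" "decomposes B3 (pairs_in V)"
    "B1 \<inter> B2 = B1 \<inter> B3" "B1 \<inter> B3 = B2 \<inter> B3" "card (B1 \<inter> B2) = n"
    unfolding three_way_def by blast
  then show "k \<in> J3 v"
    unfolding J3_def mem_Collect_eq S24_design_iff_decomposes using V
    by (intro exI[of _ V] exI[of _ B1] exI[of _ B2] exI[of _ B3]) simp
qed

theorem theorem5p3: "J3 73 = I3 73"
proof (rule set_eqI)
  fix k
  have I3: "k \<in> I3 73 \<longleftrightarrow> 0 \<le> k \<and> (k \<le> 430 \<or> k = 438)"
    by (auto simp: I3_def num_blocks_def)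
  show "k \<in> J3 73 \<longleftrightarrow> k \<in> I3 73"
  proof
    assume "k \<in> J3 73"
    then obtain V :: "nat set" and n where V: "finite V" "card V = 73" "three_way (pairs_in V) n" "k = int n"
      unfolding J3_iff_three_way by blast
    have "card (pairs_in V) = 6 * 438"
      unfolding pairs_in_def using V(1,2) by (simp add: n_subsets choose_two)
    then show "k \<in> I3 73"
      using three_way_bound[OF V(3)] V(4) I3 by auto
  next
    assume "k \<in> I3 73"
    then have k: "k = int (nat k)" "nat k \<le> 430 \<or> nat k = 438"
      using I3 by auto
    have "three_way (pairs_in {..<73 :: nat}) (nat k)"
      using k(2) by (rule three_way_73_all)
    then show "k \<in> J3 73"
      unfolding J3_iff_three_way using k(1) by (intro exI[of _ "{..<73}"] exI[of _ "nat k"]) simp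
  qed
qed

end
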